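(* Let $H=H_L\oplus H_I$ be a finite-dimensional Hilbert space, where $H_L$ is spanned by the computational basis states $|q\rangle$ with $q\le K$ and $H_I$ is spanned by the computational basis states $|q\rangle$ with $q>K$. Let $M$ be a set of basis states of $H_L$, let $O_M$ be the oracle that flips the sign of every basis state in $M$ and fixes every other basis state, let $|s_L\rangle=\frac{1}{\sqrt{N_L}}\sum_{q\le K}|q\rangle$ with $N_L=\dim H_L$, let $D_L=I-2|s_L\rangle\langle s_L|$, and define the constrained Grover iterate $\mathbb{G}_{CAP}=D_LO_M$ on $H$. Then $H_L$ and $H_I$ are invariant subspaces of $\mathbb{G}_{CAP}$, and the eigenphases of $\mathbb{G}_{CAP}$ that drive amplitude amplification for the marked states $M$ (that is, the eigenphases of the restriction of $\mathbb{G}_{CAP}$ to $H_L$) are identical to those of the usual Grover operator $G_L$ acting on $H_L$.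
   Context: The computational basis of $H$ is $\{|q\rangle : 0\le q\le 2^Q-1\}$ with $Q=\lceil\log_2(K+1)\rceil$; $q$ is a queue length, $K$ is the buffer capacity, states with $q\le K$ are called legal and states with $q>K$ illegal. The capacity oracle $\mathrm{CAP}$ is the operator acting as $+1$ on $H_L$ and as $-1$ on $H_I$. The usual Grover operator acting on $H_L$ is, with the sign convention for the diffusion operator used here, the operator $G_L=(I_{H_L}-2|s_L\rangle\langle s_L|)\,O_M^{L}$ on $H_L$, where $O_M^{L}:H_L\to H_L$ flips the sign of the basis states in $M$ and fixes the other basis states of $H_L$. An eigenphase of a unitary operator is the argument of one of its eigenvalues. *)

theory Defs
  imports Complex_Main "HOL-Library.FuncSet" "Jordan_Normal_Form.DL_Rank"
begin

definition num_qubits :: "nat \<Rightarrow> nat" where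
  "num_qubits K = nat \<lceil>log 2 (real (K + 1))\<rceil>"

definition dim_H :: "nat \<Rightarrow> nat" where
  "dim_H K = 2 ^ num_qubits K"

abbreviation H_space :: "nat \<Rightarrow> (complex, complex vec) module" where
  "H_space K \<equiv> module_vec TYPE(complex) (dim_H K)"

definition ket :: "nat \<Rightarrow> nat \<Rightarrow> complex vec" where
  "ket K q = unit_vec (dim_H K) q"

definition H_L :: "nat \<Rightarrow> complex vec set" where
  "H_L K = LinearCombinations.module.span class_ring (H_space K) (ket K ` {..K})"

definition H_I :: "nat \<Rightarrow> complex vec set" where
  "H_I K = LinearCombinations.module.span class_ring (H_space K) (ket K ` {K<..<dim_H K})"

definition subspace_dim :: "nat \<Rightarrow> complex vec set \<Rightarrow> nat" where
  "subspace_dim K W = vectorspace.dim class_ring ((H_space K)\<lparr>carrier := W\<rparr>)"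

definition N_L :: "nat \<Rightarrow> nat" where
  "N_L K = subspace_dim K (H_L K)"

definition s_L :: "nat \<Rightarrow> complex vec" where
  "s_L K = complex_of_real (1 / sqrt (real (N_L K))) \<cdot>\<^sub>v
             finsum_vec TYPE(complex) (dim_H K) (ket K) {..K}"

definition ket_bra :: "complex vec \<Rightarrow> complex vec \<Rightarrow> complex mat" where
  "ket_bra u v = mat (dim_vec u) (dim_vec v) (\<lambda>(i, j). u $ i * cnj (v $ j))"

(* Basis states are identified with their labels, so a set of marked basis states is a
   set M of labels; the oracle is linear and hence determined by its diagonal. *)
definition O_M :: "nat \<Rightarrow> nat set \<Rightarrow> complex mat" where
  "O_M K M = mat_diag (dim_H K) (\<lambda>q. if q \<in> M then - 1 else 1)"

definition D_L :: "nat \<Rightarrow> complex mat" where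
  "D_L K = 1\<^sub>m (dim_H K) - 2 \<cdot>\<^sub>m ket_bra (s_L K) (s_L K)"

definition G_CAP :: "nat \<Rightarrow> nat set \<Rightarrow> complex mat" where
  "G_CAP K M = D_L K * O_M K M"

(* The usual Grover operator is given intrinsically on H_L, as a map of H_L to itself
   (extensional, i.e. undefined outside H_L).  The oracle is the linear extension of its
   values on the basis kets of H_L. *)
definition oracle_L :: "nat \<Rightarrow> nat set \<Rightarrow> complex vec \<Rightarrow> complex vec" where
  "oracle_L K M = (\<lambda>v\<in>H_L K. finsum_vec TYPE(complex) (dim_H K)
      (\<lambda>q. v $ q \<cdot>\<^sub>v (if q \<in> M then - ket K q else ket K q)) {..K})"

(* The inner product of s_L with v, conjugate linear in s_L, is v \<bullet>c s_L. *)
definition diffusion_L :: "nat \<Rightarrow> complex vec \<Rightarrow> complex vec" where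
  "diffusion_L K = (\<lambda>v\<in>H_L K. v - (2 * (v \<bullet>c s_L K)) \<cdot>\<^sub>v s_L K)"

definition G_L :: "nat \<Rightarrow> nat set \<Rightarrow> complex vec \<Rightarrow> complex vec" where
  "G_L K M = compose (H_L K) (diffusion_L K) (oracle_L K M)"

definition invariant_subspace :: "nat \<Rightarrow> complex mat \<Rightarrow> complex vec set \<Rightarrow> bool" where
  "invariant_subspace K A W \<longleftrightarrow>
     VectorSpace.subspace class_ring W (H_space K) \<and> (\<forall>v\<in>W. A *\<^sub>v v \<in> W)"

definition restriction :: "complex mat \<Rightarrow> complex vec set \<Rightarrow> complex vec \<Rightarrow> complex vec" where
  "restriction A W = (\<lambda>v\<in>W. A *\<^sub>v v)"

definition eigenspace_on :: "complex vec set \<Rightarrow> (complex vec \<Rightarrow> complex vec) \<Rightarrow> complex \<Rightarrow> complex vec set" where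
  "eigenspace_on W T z = {v \<in> W. T v = z \<cdot>\<^sub>v v}"

definition eigenvalue_on :: "complex vec set \<Rightarrow> (complex vec \<Rightarrow> complex vec) \<Rightarrow> complex \<Rightarrow> bool" where
  "eigenvalue_on W T z \<longleftrightarrow> (\<exists>v \<in> eigenspace_on W T z. v \<noteq> 0\<^sub>v (dim_vec v))"

definition eigenphases :: "complex vec set \<Rightarrow> (complex vec \<Rightarrow> complex vec) \<Rightarrow> real set" where
  "eigenphases W T = {Arg z |z. eigenvalue_on W T z}"

(* For unitary T the only eigenvalue with argument \<theta> can be cis \<theta>, and algebraic and
   geometric multiplicities agree. *)
definition phase_multiplicity ::
    "nat \<Rightarrow> complex vec set \<Rightarrow> (complex vec \<Rightarrow> complex vec) \<Rightarrow> real \<Rightarrow> nat" where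
  "phase_multiplicity K W T \<theta> = subspace_dim K (eigenspace_on W T (cis \<theta>))"

lemma K_less_dim_H: "K < dim_H K"
proof -
  have "log 2 (real (K + 1)) \<le> real (num_qubits K)"
    unfolding num_qubits_def by linarith
  then have "real (K + 1) \<le> 2 powr real (num_qubits K)"
    by (simp add: log_le_iff)
  then have "real (K + 1) \<le> real (dim_H K)"
    by (simp add: dim_H_def powr_realpow)
  then show ?thesis by linarith
qed

lemma ket_image_indpt:
  fixes K :: nat
  assumes "S \<subseteq> {..<dim_H K}"
  shows "\<not> LinearCombinations.module.lin_dep class_ring (H_space K) (ket K ` S)"
proof -
  interpret vec_space "TYPE(complex)" "dim_H K" .
  have "ket K ` S \<subseteq> set (unit_vecs (dim_H K))"
    using assms by (auto simp: unit_vecs_def ket_def)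
  then show ?thesis
    using unit_vecs_basis subset_li_is_li basis_def by blast
qed

lemma N_L_eq: "N_L K = K + 1"
proof -
  interpret vec_space "TYPE(complex)" "dim_H K" .
  have S: "{..K} \<subseteq> {..<dim_H K}" using K_less_dim_H[of K] by auto
  have sub: "ket K ` {..K} \<subseteq> carrier_vec (dim_H K)" by (auto simp: ket_def)
  have inj: "inj_on (ket K) {..K}"
    using S by (auto intro!: inj_onI simp: ket_def unit_vec_eq)
  have "maximal (ket K ` {..K}) (\<lambda>T. T \<subseteq> ket K ` {..K} \<and> lin_indpt T)"
    using ket_image_indpt[OF S] by (auto simp: maximal_def)
  then have "vectorspace.dim class_ring (vs (span (ket K ` {..K}))) = card (ket K ` {..K})"
    using dim_span[of "ket K ` {..K}"] sub by auto
  then show ?thesis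
    using inj by (simp add: N_L_def subspace_dim_def H_L_def card_image)
qed

lemma ket_in_H_L:
  assumes "q \<le> K"
  shows "ket K q \<in> H_L K"
proof -
  interpret vec_space "TYPE(complex)" "dim_H K" .
  have "ket K ` {..K} \<subseteq> carrier_vec (dim_H K)" by (auto simp: ket_def)
  then show ?thesis
    unfolding H_L_def using assms in_own_span[of "ket K ` {..K}"] by auto
qed

lemma O_M_ket:
  assumes "q < dim_H K"
  shows "O_M K M *\<^sub>v ket K q = (if q \<in> M then - ket K q else ket K q)"
proof (intro eq_vecI)
  fix i assume "i < dim_vec (if q \<in> M then - ket K q else ket K q)"
  then have i: "i < dim_H K" by (auto simp: ket_def split: if_splits)
  then have "(O_M K M *\<^sub>v ket K q) $ i = row (O_M K M) i $ q"
    using assms unfolding ket_def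
    by (subst index_mult_mat_vec) (auto simp: O_M_def mat_diag_def)
  then show "(O_M K M *\<^sub>v ket K q) $ i = (if q \<in> M then - ket K q else ket K q) $ i"
    using i assms by (simp add: ket_def O_M_def mat_diag_def)
qed (simp add: O_M_def ket_def mat_diag_def)

lemma oracle_L_ket:
  assumes "q \<le> K"
  shows "oracle_L K M (ket K q) = (if q \<in> M then - ket K q else ket K q)"
proof -
  let ?f = "\<lambda>p. ket K q $ p \<cdot>\<^sub>v (if p \<in> M then - ket K p else ket K p)"
  let ?S = "finsum_vec TYPE(complex) (dim_H K) ?f {..K}"
  have q: "q < dim_H K" using assms K_less_dim_H[of K] by simp
  have f: "?f \<in> {..K} \<rightarrow> carrier_vec (dim_H K)" by (auto simp: ket_def)
  have "?S = (if q \<in> M then - ket K q else ket K q)"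
  proof (intro eq_vecI)
    fix i assume "i < dim_vec (if q \<in> M then - ket K q else ket K q)"
    then have i: "i < dim_H K" by (auto simp: ket_def split: if_splits)
    have "?S $ i = (\<Sum>p\<le>K. ?f p $ i)"
      using i f by (intro index_finsum_vec) auto
    also have "\<dots> = (\<Sum>p\<le>K. if p = q then (if q \<in> M then - ket K q else ket K q) $ i else 0)"
      using i q K_less_dim_H[of K] by (intro sum.cong) (auto simp: ket_def)
    finally show "?S $ i = (if q \<in> M then - ket K q else ket K q) $ i"
      using assms by simp
  next
    have "?S \<in> carrier_vec (dim_H K)" using f by (intro finsum_vec_closed)
    then show "dim_vec ?S = dim_vec (if q \<in> M then - ket K q else ket K q)"
      by (simp add: ket_def)
  qed
  then show ?thesis
    using ket_in_H_L[OF assms] by (simp add: oracle_L_def)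
qed

end

theory Submission
  imports Defs
begin

text \<open>
  Both \<open>H_L\<close> and \<open>H_I\<close> are coordinate subspaces. The oracle is diagonal, and the diffusion
  \<open>w \<mapsto> w - 2\<langle>s_L|w\<rangle> s_L\<close> only moves \<open>w\<close> along \<open>s_L \<in> H_L\<close>, and not at all if \<open>w \<in> H_I\<close> because
  \<open>s_L\<close> is orthogonal to \<open>H_I\<close>. Hence both subspaces are invariant, and on \<open>H_L\<close> the
  constrained iterate and the usual Grover operator are the same function.
\<close>

text \<open>Kets are standard unit vectors, so the coefficients of a linear combination are its
  coordinates. This turns span membership into vanishing of coordinates, the form in which both
  invariance claims are checked.\<close>

lemma span_ket_image:
  assumes S: "S \<subseteq> {..<dim_H K}"
  shows "LinearCombinations.module.span class_ring (H_space K) (ket K ` S)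
    = {v \<in> carrier_vec (dim_H K). \<forall>i<dim_H K. i \<notin> S \<longrightarrow> v $ i = 0}" (is "_ = ?C")
proof -
  interpret vec_space "TYPE(complex)" "dim_H K" .
  have sub: "ket K ` S \<subseteq> carrier_vec (dim_H K)"
    by (auto simp: ket_def)
  have inj: "inj_on (ket K) S"
    using S by (auto intro!: inj_onI simp: ket_def unit_vec_eq)
  have fin: "finite S"
    using S finite_subset by blast
  have span: "span (ket K ` S) = {lincomb a (ket K ` S) |a. a \<in> ket K ` S \<rightarrow> carrier class_ring}"
    using finite_span[of "ket K ` S"] fin sub by simp
  have idx: "lincomb a (ket K ` S) $ i = (if i \<in> S then a (ket K i) else 0)"
    if i: "i < dim_H K" for a i
  proof -
    \<comment> \<open>\<open>lincomb\<close> sums over a set of vectors; injectivity of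
      \<open>ket K\<close> on \<open>S\<close> allows summing over labels instead.\<close>
    have "lincomb a (ket K ` S) $ i = (\<Sum>q\<in>S. a (ket K q) * ket K q $ i)"
      by (simp add: lincomb_index[OF i sub] sum.reindex[OF inj])
    also have "\<dots> = (\<Sum>q\<in>S. if q = i then a (ket K i) else 0)"
      using S i by (intro sum.cong) (auto simp: ket_def)
    finally show ?thesis
      using fin by simp
  qed
  have dim: "lincomb a (ket K ` S) \<in> carrier_vec (dim_H K)" for a
    using lincomb_closed[of "ket K ` S" a] sub by (simp add: class_ring_simps)
  have "v \<in> span (ket K ` S)" if "v \<in> ?C" for v
  proof -
    \<comment> \<open>Coefficients are indexed by vectors rather than labels; at
      \<open>ket K i\<close> this choice reads off \<open>v $ i\<close>.\<close>
    have "v = lincomb (\<lambda>x. x \<bullet> v) (ket K ` S)"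
    proof (rule eq_vecI)
      fix i assume "i < dim_vec (lincomb (\<lambda>x. x \<bullet> v) (ket K ` S))"
      then have "i < dim_H K" using dim by (metis carrier_vecD)
      then show "v $ i = lincomb (\<lambda>x. x \<bullet> v) (ket K ` S) $ i"
        using that by (simp add: idx) (simp add: ket_def)
    next
      show "dim_vec v = dim_vec (lincomb (\<lambda>x. x \<bullet> v) (ket K ` S))"
        using that dim by (metis (no_types, lifting) carrier_vecD mem_Collect_eq)
    qed
    then show ?thesis
      unfolding span by (auto simp: class_ring_simps)
  qed
  moreover have "v \<in> ?C" if "v \<in> span (ket K ` S)" for v
    using that dim idx unfolding span by auto
  ultimately show ?thesis by blast
qed

lemma mem_H_L_iff:
  "v \<in> H_L K \<longleftrightarrow> v \<in> carrier_vec (dim_H K) \<and> (\<forall>i<dim_H K. K < i \<longrightarrow> v $ i = 0)"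
  unfolding H_L_def using K_less_dim_H[of K] by (subst span_ket_image) auto

lemma mem_H_I_iff:
  "v \<in> H_I K \<longleftrightarrow> v \<in> carrier_vec (dim_H K) \<and> (\<forall>i\<le>K. v $ i = 0)"
  unfolding H_I_def using K_less_dim_H[of K]
  by (subst span_ket_image) (auto simp: not_less)

lemma subspace_H_L: "VectorSpace.subspace class_ring (H_L K) (H_space K)"
proof -
  interpret vec_space "TYPE(complex)" "dim_H K" .
  show ?thesis
    unfolding H_L_def by (rule span_is_subspace) (auto simp: ket_def)
qed

lemma subspace_H_I: "VectorSpace.subspace class_ring (H_I K) (H_space K)"
proof -
  interpret vec_space "TYPE(complex)" "dim_H K" .
  show ?thesis
    unfolding H_I_def by (rule span_is_subspace) (auto simp: ket_def)
qed

lemma s_L_carrier [simp]: "s_L K \<in> carrier_vec (dim_H K)"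
  unfolding s_L_def by (intro smult_carrier_vec[THEN iffD2] finsum_vec_closed) (auto simp: ket_def)

lemma dim_s_L [simp]: "dim_vec (s_L K) = dim_H K"
  using s_L_carrier by (rule carrier_vecD)

text \<open>The normalisation comes from \<open>N_L K = K + 1\<close>. The zeros beyond
  \<open>K\<close> serve twice: they put \<open>s_L\<close> into \<open>H_L\<close> and make it
  orthogonal to \<open>H_I\<close>.\<close>

lemma s_L_index:
  assumes "i < dim_H K"
  shows "s_L K $ i = (if i \<le> K then complex_of_real (1 / sqrt (real (K + 1))) else 0)"
proof -
  let ?S = "finsum_vec TYPE(complex) (dim_H K) (ket K) {..K}"
  have S: "?S \<in> carrier_vec (dim_H K)"
    by (intro finsum_vec_closed) (auto simp: ket_def)
  have "?S $ i = (\<Sum>q\<le>K. ket K q $ i)"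
    using assms by (intro index_finsum_vec) (auto simp: ket_def)
  also have "\<dots> = (\<Sum>q\<le>K. if q = i then 1 else 0)"
    using assms K_less_dim_H[of K] by (intro sum.cong) (auto simp: ket_def)
  finally have "?S $ i = (if i \<le> K then 1 else 0)"
    by simp
  then show ?thesis
    using S assms by (simp add: s_L_def N_L_eq)
qed

lemma O_M_carrier [simp]: "O_M K M \<in> carrier_mat (dim_H K) (dim_H K)"
  by (simp add: O_M_def)

lemma O_M_mult_vec_index:
  assumes "v \<in> carrier_vec (dim_H K)" "i < dim_H K"
  shows "(O_M K M *\<^sub>v v) $ i = (if i \<in> M then - (v $ i) else v $ i)"
proof -
  \<comment> \<open>Only the diagonal entry of row \<open>i\<close> contributes. The delta sum is
    kept uncollapsed at first so that the two sums can be compared termwise.\<close>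
  have "(O_M K M *\<^sub>v v) $ i
      = (\<Sum>j = 0..<dim_H K. if j = i then (if i \<in> M then - (v $ i) else v $ i) else 0)"
    using assms by (auto simp: O_M_def mat_diag_def scalar_prod_def simp del: sum.delta sum.delta'
        intro!: sum.cong)
  then show ?thesis
    using assms by simp
qed

text \<open>This is the action of the rank-one operator |u><v|; the conjugation in
  \<open>w \<bullet>c v\<close> falls on \<open>v\<close>, matching the \<open>cnj\<close> in
  \<open>ket_bra\<close>.\<close>

lemma ket_bra_mult_vec:
  assumes "w \<in> carrier_vec (dim_vec v)"
  shows "ket_bra u v *\<^sub>v w = (w \<bullet>c v) \<cdot>\<^sub>v u"
  using assms
  by (intro eq_vecI) (auto simp: ket_bra_def scalar_prod_def sum_distrib_left mult_ac intro!: sum.cong)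

lemma D_L_mult_vec:
  assumes w: "w \<in> carrier_vec (dim_H K)"
  shows "D_L K *\<^sub>v w = w - (2 * (w \<bullet>c s_L K)) \<cdot>\<^sub>v s_L K"
proof -
  let ?B = "ket_bra (s_L K) (s_L K)"
  have B: "?B \<in> carrier_mat (dim_H K) (dim_H K)"
    by (simp add: ket_bra_def)
  have "(2 \<cdot>\<^sub>m ?B) *\<^sub>v w = 2 \<cdot>\<^sub>v (?B *\<^sub>v w)"
    using B w by (intro eq_vecI) auto
  also have "\<dots> = (2 * (w \<bullet>c s_L K)) \<cdot>\<^sub>v s_L K"
    using w by (simp add: ket_bra_mult_vec smult_smult_assoc)
  finally show ?thesis
    unfolding D_L_def using B w
    by (subst minus_mult_distrib_mat_vec[of _ "dim_H K" "dim_H K"]) auto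
qed

lemma G_CAP_mult_vec:
  assumes "v \<in> carrier_vec (dim_H K)"
  shows "G_CAP K M *\<^sub>v v =
    O_M K M *\<^sub>v v - (2 * ((O_M K M *\<^sub>v v) \<bullet>c s_L K)) \<cdot>\<^sub>v s_L K"
proof -
  have "D_L K \<in> carrier_mat (dim_H K) (dim_H K)"
    by (auto simp: D_L_def ket_bra_def)
  then have "G_CAP K M *\<^sub>v v = D_L K *\<^sub>v (O_M K M *\<^sub>v v)"
    unfolding G_CAP_def using assms by (intro assoc_mult_mat_vec) auto
  also have "O_M K M *\<^sub>v v \<in> carrier_vec (dim_H K)"
    using assms by (intro mult_mat_vec_carrier) auto
  then have "D_L K *\<^sub>v (O_M K M *\<^sub>v v) =
      O_M K M *\<^sub>v v - (2 * ((O_M K M *\<^sub>v v) \<bullet>c s_L K)) \<cdot>\<^sub>v s_L K"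
    by (rule D_L_mult_vec)
  finally show ?thesis .
qed

lemma O_M_mult_vec_H_L:
  assumes "v \<in> H_L K"
  shows "O_M K M *\<^sub>v v \<in> H_L K"
  using assms by (auto simp: mem_H_L_iff O_M_mult_vec_index intro!: mult_mat_vec_carrier)

lemma O_M_mult_vec_H_I:
  assumes "v \<in> H_I K"
  shows "O_M K M *\<^sub>v v \<in> H_I K"
  using assms K_less_dim_H[of K]
  by (auto simp: mem_H_I_iff O_M_mult_vec_index intro!: mult_mat_vec_carrier)

lemma H_I_orthogonal_s_L:
  assumes "w \<in> H_I K"
  shows "w \<bullet>c s_L K = 0"
proof -
  have "w $ i * cnj (s_L K $ i) = 0" if "i < dim_H K" for i
    using assms that by (cases "i \<le> K") (simp_all add: mem_H_I_iff s_L_index)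
  then show ?thesis
    by (auto simp: scalar_prod_def intro!: sum.neutral)
qed

lemma G_CAP_mult_vec_H_L:
  assumes "v \<in> H_L K"
  shows "G_CAP K M *\<^sub>v v \<in> H_L K"
proof -
  have v: "v \<in> carrier_vec (dim_H K)"
    using assms by (simp add: mem_H_L_iff)
  show ?thesis
    \<comment> \<open>Subtracting any multiple of \<open>s_L\<close> leaves the coordinates beyond
      \<open>K\<close> at zero.\<close>
    using O_M_mult_vec_H_L[OF assms, of M] unfolding G_CAP_mult_vec[OF v]
    by (simp add: mem_H_L_iff s_L_index)
qed

lemma G_CAP_mult_vec_H_I:
  assumes "v \<in> H_I K"
  shows "G_CAP K M *\<^sub>v v \<in> H_I K"
proof -
  have v: "v \<in> carrier_vec (dim_H K)"
    using assms by (simp add: mem_H_I_iff)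
  have O: "O_M K M *\<^sub>v v \<in> H_I K"
    using assms by (rule O_M_mult_vec_H_I)
  \<comment> \<open>By orthogonality the diffusion subtracts the zero multiple of
    \<open>s_L\<close>, so on \<open>H_I\<close> the iterate reduces to the oracle.\<close>
  have "w - 0 \<cdot>\<^sub>v s_L K = w" if "w \<in> carrier_vec (dim_H K)" for w
    using that by (intro eq_vecI) auto
  moreover have "O_M K M *\<^sub>v v \<in> carrier_vec (dim_H K)"
    using O by (simp add: mem_H_I_iff)
  ultimately have "G_CAP K M *\<^sub>v v = O_M K M *\<^sub>v v"
    unfolding G_CAP_mult_vec[OF v] H_I_orthogonal_s_L[OF O] by simp
  with O show ?thesis by simp
qed

text \<open>Both maps flip the same signs coordinatewise. The sum over labels up to \<open>K\<close>
  captures all of \<open>v\<close>, since its coordinates beyond \<open>K\<close> vanish.\<close>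

lemma oracle_L_eq_O_M:
  assumes "v \<in> H_L K"
  shows "oracle_L K M v = O_M K M *\<^sub>v v"
proof -
  let ?f = "\<lambda>q. v $ q \<cdot>\<^sub>v (if q \<in> M then - ket K q else ket K q)"
  let ?S = "finsum_vec TYPE(complex) (dim_H K) ?f {..K}"
  have f: "?f \<in> {..K} \<rightarrow> carrier_vec (dim_H K)"
    by (auto simp: ket_def)
  have O: "O_M K M *\<^sub>v v \<in> carrier_vec (dim_H K)"
    using O_M_mult_vec_H_L[OF assms] by (simp add: mem_H_L_iff)
  have "?S = O_M K M *\<^sub>v v"
  proof (intro eq_vecI)
    fix i assume "i < dim_vec (O_M K M *\<^sub>v v)"
    then have i: "i < dim_H K" using O by (metis carrier_vecD)
    have "?S $ i = (\<Sum>q\<le>K. ?f q $ i)"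
      using i f by (intro index_finsum_vec) auto
    also have "\<dots> = (\<Sum>q\<le>K. if q = i then (if i \<in> M then - (v $ i) else v $ i) else 0)"
      using i K_less_dim_H[of K] by (intro sum.cong) (auto simp: ket_def)
    also have "\<dots> = (O_M K M *\<^sub>v v) $ i"
      using assms i by (auto simp: mem_H_L_iff O_M_mult_vec_index)
    finally show "?S $ i = (O_M K M *\<^sub>v v) $ i" .
  next
    show "dim_vec ?S = dim_vec (O_M K M *\<^sub>v v)"
      using finsum_vec_closed[OF f] O by (metis carrier_vecD)
  qed
  then show ?thesis
    using assms by (simp add: oracle_L_def)
qed

text \<open>Equality holds between total functions because both sides are extensional: outside
  \<open>H_L\<close> each is \<open>undefined\<close>. Eigenphases and multiplicities then agree
  with no spectral computation.\<close>

lemma restriction_G_CAP_eq_G_L: "restriction (G_CAP K M) (H_L K) = G_L K M"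
proof
  fix v
  show "restriction (G_CAP K M) (H_L K) v = G_L K M v"
  proof (cases "v \<in> H_L K")
    case True
    then have "v \<in> carrier_vec (dim_H K)"
      by (simp add: mem_H_L_iff)
    with True show ?thesis
      by (simp add: restriction_def G_L_def compose_def diffusion_L_def oracle_L_eq_O_M
          O_M_mult_vec_H_L G_CAP_mult_vec)
  qed (simp add: restriction_def G_L_def compose_def)
qed

theorem lemma1:
  fixes K :: nat and M :: "nat set"
  assumes "M \<subseteq> {..K}"
  shows "invariant_subspace K (G_CAP K M) (H_L K)
       \<and> invariant_subspace K (G_CAP K M) (H_I K)
       \<and> eigenphases (H_L K) (restriction (G_CAP K M) (H_L K)) = eigenphases (H_L K) (G_L K M)
       \<and> (\<forall>\<theta>. phase_multiplicity K (H_L K) (restriction (G_CAP K M) (H_L K)) \<theta>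
               = phase_multiplicity K (H_L K) (G_L K M) \<theta>)"
  \<comment> \<open>After this rewriting both spectral equations are reflexive, and only the two
    invariance claims remain.\<close>
  unfolding restriction_G_CAP_eq_G_L invariant_subspace_def
  by (simp add: subspace_H_L subspace_H_I G_CAP_mult_vec_H_L G_CAP_mult_vec_H_I)

end
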